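(* Suppose $X$ is a paracompact space and $f:A\to Y$ is a map from a closed subset $A$ of $X$ to a space $Y$. Then $f$ extends to a map $X\to Y$ if $Y$ is the union of a family $\{Y_s\}_{s\in S}$ of its subspaces with the following properties: (a) each $Y_s$ is an absolute extensor of $X$; (b) for any two elements $s$ and $t$ of $S$ there is $u\in S$ such that $Y_s\cup Y_t\subset Y_u$; (c) $A=\bigcup_{s\in S}\operatorname{Int}_A(f^{-1}(Y_s))$.
   Context: Maps are continuous. Paracompact spaces are assumed Hausdorff. A space $Z$ is an absolute extensor of a space $X$ if every map $g:B\to Z$ from a closed subset $B$ of $X$ extends to a map $X\to Z$. $\operatorname{Int}_A(B)$ is the interior of $B$ relative to $A$. *)

theory Defs
  imports "HOL-Analysis.Analysis"
begin

text \<open>Paracompact spaces are Hausdorff by convention.\<close>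

definition paracompact_space :: "'a topology \<Rightarrow> bool"
  where "paracompact_space X \<longleftrightarrow>
    Hausdorff_space X \<and>
    (\<forall>\<U>. (\<forall>U\<in>\<U>. openin X U) \<and> \<Union>\<U> = topspace X \<longrightarrow>
      (\<exists>\<V>. (\<forall>V\<in>\<V>. openin X V) \<and> \<Union>\<V> = topspace X \<and>
           (\<forall>V\<in>\<V>. \<exists>U\<in>\<U>. V \<subseteq> U) \<and> locally_finite_in X \<V>))"

definition absolute_extensor_of :: "'b topology \<Rightarrow> 'a topology \<Rightarrow> bool"
  where "absolute_extensor_of Z X \<longleftrightarrow>
    (\<forall>B g. closedin X B \<and> continuous_map (subtopology X B) Z g \<longrightarrow>
      (\<exists>h. continuous_map X Z h \<and> (\<forall>x\<in>B. h x = g x)))"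

end

theory Submission
  imports Defs
begin

text \<open>
  Let \<open>\<V>\<close> be a locally finite open cover of \<open>X\<close>, and for a point \<open>x\<close> let \<open>\<V>\<^sub>x\<close> be the finite set of
  its members that contain \<open>x\<close>. The sets \<open>C T = {x. \<V>\<^sub>x \<subseteq> T}\<close>, for finite \<open>T \<subseteq> \<V>\<close>, filter \<open>X\<close>
  as the faces of the nerve filter a simplicial complex. They are closed, being complements of
  unions of members of \<open>\<V>\<close>, they satisfy \<open>C T \<inter> C U = C (T \<inter> U)\<close>, and by local finiteness every
  point has a neighbourhood inside a single \<open>C T\<close>. So a map on \<open>X\<close> is the same thing as a
  compatible family of maps on the sets \<open>C T\<close>, and such a family can be built by induction on \<open>T\<close>:
  the maps on \<open>C U\<close> for \<open>U \<subset> T\<close>, together with \<open>f\<close> on \<open>A \<inter> C T\<close>, glue to a map on a closed set, and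
  this map extends as long as it takes values in a single absolute extensor \<open>Z T\<close>
  (\<open>extend_over_locally_finite_cover\<close>).

  For this the targets \<open>Z T\<close> must increase with \<open>T\<close> and \<open>f x\<close> must lie in \<open>Z \<V>\<^sub>x\<close>. Paracompactness and
  hypothesis (c) give a cover \<open>\<V>\<close> such that \<open>f\<close> maps each trace \<open>A \<inter> V\<close> into a single \<open>Y\<^sub>s\<close>, and
  the directedness (b) then gives the increasing choice of \<open>Z T\<close> among the \<open>Y\<^sub>s\<close>
  (\<open>directed_choice_on_finite_sets\<close>).
\<close>

section \<open>Increasing choices in a directed family\<close>

lemma directed_finite_upper_bound:
  assumes "finite F" "F \<subseteq> S" "S \<noteq> {}"
    and directed: "\<And>s t. s \<in> S \<Longrightarrow> t \<in> S \<Longrightarrow> \<exists>u\<in>S. Ys s \<union> Ys t \<subseteq> Ys u"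
  shows "\<exists>u\<in>S. \<forall>s\<in>F. Ys s \<subseteq> Ys u"
  using assms(1,2)
proof (induction F)
  case empty
  then show ?case using \<open>S \<noteq> {}\<close> by auto
next
  case (insert a F)
  then obtain u where u: "u \<in> S" "\<forall>s\<in>F. Ys s \<subseteq> Ys u" by auto
  obtain w where "w \<in> S" "Ys a \<union> Ys u \<subseteq> Ys w"
    using directed[of a u] insert.prems u(1) by auto
  then show ?case using u by (intro bexI[of _ w]) auto
qed

text \<open>
  By induction on \<open>T\<close>: a finite set has only finitely many proper subsets, so directedness provides
  an index that dominates the ones already chosen for them.
\<close>

lemma directed_choice_on_finite_sets:
  fixes Ys :: "'s \<Rightarrow> 'b set" and \<tau> :: "'v \<Rightarrow> 's"
  assumes "S \<noteq> {}"
    and directed: "\<And>s t. s \<in> S \<Longrightarrow> t \<in> S \<Longrightarrow> \<exists>u\<in>S. Ys s \<union> Ys t \<subseteq> Ys u"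
    and \<tau>: "\<And>v. v \<in> \<V> \<Longrightarrow> \<tau> v \<in> S"
  shows "\<exists>\<sigma>. \<forall>T. finite T \<and> T \<subseteq> \<V> \<longrightarrow> \<sigma> T \<in> S \<and>
    (\<forall>v\<in>T. Ys (\<tau> v) \<subseteq> Ys (\<sigma> T)) \<and> (\<forall>U. U \<subseteq> T \<longrightarrow> Ys (\<sigma> U) \<subseteq> Ys (\<sigma> T))"
proof -
  define P where "P \<sigma> T r \<longleftrightarrow> (finite T \<and> T \<subseteq> \<V> \<longrightarrow>
      r \<in> S \<and> (\<forall>v\<in>T. Ys (\<tau> v) \<subseteq> Ys r) \<and> (\<forall>U. U \<subset> T \<longrightarrow> Ys (\<sigma> U) \<subseteq> Ys r))"
    for \<sigma> :: "'v set \<Rightarrow> 's" and T r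
  have "\<exists>\<sigma>. \<forall>T. P \<sigma> T (\<sigma> T)"
  proof (rule dependent_wf_choice[OF wf_finite_psubset])
    fix \<sigma> \<sigma>' :: "'v set \<Rightarrow> 's" and T r
    assume "\<And>U. (U, T) \<in> finite_psubset \<Longrightarrow> \<sigma> U = \<sigma>' U"
    then show "P \<sigma> T r = P \<sigma>' T r" by (simp add: P_def)
  next
    fix T and \<sigma> :: "'v set \<Rightarrow> 's"
    assume IH: "\<And>U. (U, T) \<in> finite_psubset \<Longrightarrow> P \<sigma> U (\<sigma> U)"
    show "\<exists>r. P \<sigma> T r"
    proof (cases "finite T \<and> T \<subseteq> \<V>")
      case True
      then have "\<sigma> U \<in> S" if "U \<subset> T" for U
        using IH[of U] that by (auto simp: finite_psubset_def P_def dest: finite_subset)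
      then have "\<tau> ` T \<union> \<sigma> ` {U. U \<subset> T} \<subseteq> S" using \<tau> True by auto
      moreover have "finite (\<tau> ` T \<union> \<sigma> ` {U. U \<subset> T})"
      proof -
        have "{U. U \<subset> T} \<subseteq> Pow T" by auto
        then show ?thesis using True by (simp add: finite_subset)
      qed
      ultimately obtain u where "u \<in> S" "\<forall>s\<in>\<tau> ` T \<union> \<sigma> ` {U. U \<subset> T}. Ys s \<subseteq> Ys u"
        using directed_finite_upper_bound[OF _ _ \<open>S \<noteq> {}\<close> directed] by meson
      then have "P \<sigma> T u" by (auto simp: P_def)
      then show ?thesis by blast
    qed (auto simp: P_def)
  qed
  then obtain \<sigma> where \<sigma>: "\<And>T. P \<sigma> T (\<sigma> T)" by blast
  show ?thesis
  proof (intro exI allI impI)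
    fix T assume T: "finite T \<and> T \<subseteq> \<V>"
    have "Ys (\<sigma> U) \<subseteq> Ys (\<sigma> T)" if "U \<subseteq> T" for U
      using \<sigma>[of T] T that by (cases "U = T") (auto simp: P_def)
    then show "\<sigma> T \<in> S \<and> (\<forall>v\<in>T. Ys (\<tau> v) \<subseteq> Ys (\<sigma> T)) \<and>
        (\<forall>U. U \<subseteq> T \<longrightarrow> Ys (\<sigma> U) \<subseteq> Ys (\<sigma> T))"
      using \<sigma>[of T] T by (simp add: P_def)
  qed
qed

section \<open>Gluing along closed and open covers\<close>

lemma continuous_map_finite_closed_cover:
  assumes "finite \<C>" "\<And>C. C \<in> \<C> \<Longrightarrow> closedin X C"
    and cont: "\<And>C. C \<in> \<C> \<Longrightarrow> continuous_map (subtopology X C) Y g"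
  shows "continuous_map (subtopology X (\<Union>\<C>)) Y g"
proof (rule pasting_lemma_closed[where I = \<C> and T = "\<lambda>C. C" and f = "\<lambda>_. g"])
  fix C assume C: "C \<in> \<C>"
  then show "closedin (subtopology X (\<Union>\<C>)) C"
    using assms(2) by (meson Union_upper closedin_subset_topspace)
  show "continuous_map (subtopology (subtopology X (\<Union>\<C>)) C) Y g"
    using cont[OF C] C by (simp add: subtopology_subtopology Int_absorb1 Union_upper)
qed (use assms(1) in auto)

lemma continuous_map_local:
  assumes "\<And>x. x \<in> topspace X \<Longrightarrow>
    \<exists>N h. openin X N \<and> x \<in> N \<and> continuous_map X Y h \<and> (\<forall>y\<in>N. g y = h y)"
  shows "continuous_map X Y g"
proof -
  obtain N h where N: "\<And>x. x \<in> topspace X \<Longrightarrow>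
      openin X (N x) \<and> x \<in> N x \<and> continuous_map X Y (h x) \<and> (\<forall>y\<in>N x. g y = h x y)"
    using assms by metis
  show ?thesis
  proof (rule pasting_lemma[where I = "topspace X" and T = N and f = h])
    fix x assume "x \<in> topspace X"
    then show "continuous_map (subtopology X (N x)) Y (h x)"
      using N continuous_map_from_subtopology by blast
  next
    fix x y z assume "x \<in> topspace X" "y \<in> topspace X" "z \<in> topspace X \<inter> N x \<inter> N y"
    then show "h x z = h y z" using N[of x] N[of y] by (metis IntD1 IntD2)
  next
    fix x assume "x \<in> topspace X"
    then show "\<exists>y. y \<in> topspace X \<and> x \<in> N y \<and> g x = h y x" using N by blast
  qed (use N in blast)
qed

section \<open>Extension along a locally finite cover\<close>

text \<open>
  The map \<open>h T\<close> constructed here is defined on all of \<open>X\<close>, but only its values on \<open>C T\<close> matter. The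
  compatibility condition says that for \<open>x \<in> C T\<close> the value \<open>h T x\<close> is already determined by the
  smallest possible index \<open>near x\<close>, which is why \<open>\<lambda>x. h (near x) x\<close> is the glued map.
\<close>

lemma extend_over_locally_finite_cover:
  fixes X :: "'a topology" and Y :: "'b topology" and f :: "'a \<Rightarrow> 'b"
    and \<V> :: "'a set set" and Z :: "'a set set \<Rightarrow> 'b set"
  assumes A: "closedin X A" and f: "continuous_map (subtopology X A) Y f"
    and opn: "\<And>V. V \<in> \<V> \<Longrightarrow> openin X V" and lf: "locally_finite_in X \<V>"
    and AE: "\<And>T. finite T \<Longrightarrow> T \<subseteq> \<V> \<Longrightarrow> absolute_extensor_of (subtopology Y (Z T)) X"
    and mono: "\<And>T U. finite T \<Longrightarrow> T \<subseteq> \<V> \<Longrightarrow> U \<subseteq> T \<Longrightarrow> Z U \<subseteq> Z T"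
    and fZ: "\<And>x. x \<in> A \<Longrightarrow> f x \<in> Z {V \<in> \<V>. x \<in> V}"
  obtains g where "continuous_map X Y g" "\<And>x. x \<in> A \<Longrightarrow> g x = f x"
proof -
  define near where "near x = {V \<in> \<V>. x \<in> V}" for x
  define C where "C T = {x \<in> topspace X. near x \<subseteq> T}" for T
  have near_sub: "near x \<subseteq> \<V>" for x by (auto simp: near_def)
  have A_top: "A \<subseteq> topspace X" using A closedin_subset by blast

  have closed_C: "closedin X (C T)" for T
  proof -
    have "C T = topspace X - \<Union>(\<V> - T)" by (auto simp: C_def near_def)
    moreover have "openin X (\<Union>(\<V> - T))" using opn by blast
    ultimately show ?thesis by (simp only: closedin_diff closedin_topspace)
  qed
  have near_C: "\<exists>N T. openin X N \<and> x \<in> N \<and> finite T \<and> T \<subseteq> \<V> \<and> N \<subseteq> C T"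
    if x: "x \<in> topspace X" for x
  proof -
    obtain N where N: "openin X N" "x \<in> N" "finite {V \<in> \<V>. V \<inter> N \<noteq> {}}"
      using lf x unfolding locally_finite_in_def by blast
    moreover have "N \<subseteq> C {V \<in> \<V>. V \<inter> N \<noteq> {}}"
      using openin_subset[OF N(1)] by (auto simp: C_def near_def)
    ultimately show ?thesis by blast
  qed
  have near_fin: "finite (near x)" if "x \<in> topspace X" for x
    using near_C[OF that] finite_subset by (auto simp: C_def)

  \<comment> \<open>The condition on the \<open>T\<close>-th map \<open>r\<close>, given the maps \<open>h U\<close> for \<open>U \<subset> T\<close>; requiring it only for
    finite \<open>T \<subseteq> \<V>\<close> makes proper inclusion a well-founded order for the recursion.\<close>
  define P where "P h T r \<longleftrightarrow> (finite T \<and> T \<subseteq> \<V> \<longrightarrow>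
      continuous_map X (subtopology Y (Z T)) r \<and> (\<forall>x\<in>A \<inter> C T. r x = f x) \<and>
      (\<forall>U. U \<subset> T \<longrightarrow> (\<forall>x\<in>C U. r x = h U x)))"
    for h :: "'a set set \<Rightarrow> 'a \<Rightarrow> 'b" and T r
  have "\<exists>h. \<forall>T. P h T (h T)"
  proof (rule dependent_wf_choice[OF wf_finite_psubset])
    fix h h' :: "'a set set \<Rightarrow> 'a \<Rightarrow> 'b" and T r
    assume "\<And>U. (U, T) \<in> finite_psubset \<Longrightarrow> h U = h' U"
    then show "P h T r = P h' T r" by (simp add: P_def)
  next
    fix T and h :: "'a set set \<Rightarrow> 'a \<Rightarrow> 'b"
    assume IH: "\<And>U. (U, T) \<in> finite_psubset \<Longrightarrow> P h U (h U)"
    show "\<exists>r. P h T r"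
    proof (cases "finite T \<and> T \<subseteq> \<V>")
      case True
      have hU: "continuous_map X (subtopology Y (Z U)) (h U)"
          "\<And>x. x \<in> A \<inter> C U \<Longrightarrow> h U x = f x"
          "\<And>W x. W \<subset> U \<Longrightarrow> x \<in> C W \<Longrightarrow> h U x = h W x" if "U \<subset> T" for U
      proof -
        have "P h U (h U)" "finite U \<and> U \<subseteq> \<V>"
          using IH[of U] that True finite_subset[of U T] by auto
        then show "continuous_map X (subtopology Y (Z U)) (h U)"
          "\<And>x. x \<in> A \<inter> C U \<Longrightarrow> h U x = f x"
          "\<And>W x. W \<subset> U \<Longrightarrow> x \<in> C W \<Longrightarrow> h U x = h W x"
          unfolding P_def by blast+
      qed
      \<comment> \<open>A point of \<open>A \<inter> C T\<close> may have \<open>near x = T\<close>, and there only \<open>f\<close> prescribes a value. At every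
        other point of the closed set below, \<open>near x\<close> is a proper subset of \<open>T\<close>.\<close>
      define g where "g x = (if x \<in> A then f x else h (near x) x)" for x
      define \<C> where "\<C> = insert (A \<inter> C T) (C ` {U. U \<subset> T})"
      have g_C: "g x = h U x" if "U \<subset> T" "x \<in> C U" for U x
      proof (cases "x \<in> A")
        case True
        then show ?thesis using hU(2)[of U x] that by (simp add: g_def)
      next
        case False
        have "near x \<subseteq> U" "x \<in> C (near x)" using that by (auto simp: C_def)
        then have "h U x = h (near x) x" using hU(3)[of U "near x" x] that by (cases "near x = U") auto
        then show ?thesis using False by (simp add: g_def)
      qed
      have "finite {U. U \<subset> T}" by (rule finite_subset[of _ "Pow T"]) (use True in auto)
      then have "finite \<C>" by (simp add: \<C>_def)
      moreover have closed_\<C>: "closedin X K" if "K \<in> \<C>" for K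
        using that closed_C A by (auto simp: \<C>_def)
      moreover have "continuous_map (subtopology X K) (subtopology Y (Z T)) g" if "K \<in> \<C>" for K
        using that unfolding \<C>_def
      proof (elim insertE imageE)
        assume K: "K = A \<inter> C T"
        have "continuous_map (subtopology X K) Y f"
          using continuous_map_from_subtopology_mono[OF f] K by blast
        moreover have "f x \<in> Z T" if "x \<in> K" for x
          using fZ[of x] mono[of T "near x"] that K True by (auto simp: C_def near_def)
        ultimately have "continuous_map (subtopology X K) (subtopology Y (Z T)) f"
          by (auto simp: continuous_map_in_subtopology)
        then show ?thesis by (rule continuous_map_eq) (use K in \<open>auto simp: g_def\<close>)
      next
        fix U assume K: "K = C U" and "U \<in> {U. U \<subset> T}"
        then have U: "U \<subset> T" by auto
        have "continuous_map X (subtopology Y (Z T)) (h U)"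
          using hU(1)[OF U] mono[of T U] True U
          by (auto simp: continuous_map_in_subtopology)
        then have "continuous_map (subtopology X K) (subtopology Y (Z T)) (h U)"
          by (rule continuous_map_from_subtopology)
        then show ?thesis by (rule continuous_map_eq) (use K g_C[OF U] in auto)
      qed
      ultimately have "continuous_map (subtopology X (\<Union>\<C>)) (subtopology Y (Z T)) g"
        by (intro continuous_map_finite_closed_cover)
      moreover have "closedin X (\<Union>\<C>)" by (rule closedin_Union[OF \<open>finite \<C>\<close> closed_\<C>])
      ultimately obtain r where r: "continuous_map X (subtopology Y (Z T)) r"
          "\<And>x. x \<in> \<Union>\<C> \<Longrightarrow> r x = g x"
        using AE[of T] True unfolding absolute_extensor_of_def by metis
      have "P h T r"
        unfolding P_def
      proof (intro impI conjI allI ballI)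
        fix x assume "x \<in> A \<inter> C T"
        then show "r x = f x" using r(2)[of x] by (auto simp: \<C>_def g_def)
      next
        fix U x assume "U \<subset> T" "x \<in> C U"
        then show "r x = h U x" using r(2)[of x] g_C[of U x] by (auto simp: \<C>_def)
      qed (rule r(1))
      then show ?thesis by blast
    qed (auto simp: P_def)
  qed
  then obtain h where h: "\<And>T. P h T (h T)" by blast
  have hT: "continuous_map X Y (h T)" "\<And>x. x \<in> A \<inter> C T \<Longrightarrow> h T x = f x"
      "\<And>x. x \<in> C T \<Longrightarrow> h (near x) x = h T x" if T: "finite T" "T \<subseteq> \<V>" for T
  proof -
    show "continuous_map X Y (h T)" "\<And>x. x \<in> A \<inter> C T \<Longrightarrow> h T x = f x"
      using h[of T] T by (auto simp: P_def continuous_map_in_subtopology)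
    fix x assume "x \<in> C T"
    then have "near x \<subseteq> T" "x \<in> C (near x)" by (simp_all add: C_def)
    show "h (near x) x = h T x"
    proof (cases "near x = T")
      case False
      then have "near x \<subset> T" using \<open>near x \<subseteq> T\<close> by blast
      then have "h T x = h (near x) x"
        using h[of T] T \<open>x \<in> C (near x)\<close> unfolding P_def by blast
      then show ?thesis by (rule sym)
    qed simp
  qed
  show thesis
  proof (rule that)
    show "continuous_map X Y (\<lambda>x. h (near x) x)"
    proof (rule continuous_map_local)
      fix x assume "x \<in> topspace X"
      then obtain N T where N: "openin X N" "x \<in> N" and T: "finite T" "T \<subseteq> \<V>" and "N \<subseteq> C T"
        using near_C by meson
      then have "\<forall>y\<in>N. h (near y) y = h T y" using hT(3)[OF T] by (meson subsetD)
      then show "\<exists>N h'. openin X N \<and> x \<in> N \<and> continuous_map X Y h' \<and> (\<forall>y\<in>N. h (near y) y = h' y)"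
        using N hT(1)[OF T] by (intro exI[of _ N] exI[of _ "h T"] conjI)
    qed
    fix x assume "x \<in> A"
    moreover have "x \<in> topspace X" using \<open>x \<in> A\<close> A_top by (rule subsetD[rotated])
    ultimately show "h (near x) x = f x"
      using near_fin near_sub by (intro hT(2)) (simp_all add: C_def)
  qed
qed

section \<open>The extension theorem\<close>

theorem theorem1p6:
  fixes X :: "'a topology" and Y :: "'b topology"
    and A :: "'a set" and f :: "'a \<Rightarrow> 'b"
    and S :: "'s set" and Ys :: "'s \<Rightarrow> 'b set"
  assumes "paracompact_space X"
    and "closedin X A"
    and "continuous_map (subtopology X A) Y f"
    and "S \<noteq> {}"
    and "topspace Y = (\<Union>s\<in>S. Ys s)"
    and "\<And>s. s \<in> S \<Longrightarrow> absolute_extensor_of (subtopology Y (Ys s)) X"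
    and "\<And>s t. s \<in> S \<Longrightarrow> t \<in> S \<Longrightarrow> \<exists>u\<in>S. Ys s \<union> Ys t \<subseteq> Ys u"
    and "A = (\<Union>s\<in>S. subtopology X A interior_of {x \<in> A. f x \<in> Ys s})"
  shows "\<exists>g. continuous_map X Y g \<and> (\<forall>x\<in>A. g x = f x)"
proof -
  have A_top: "A \<subseteq> topspace X" using assms(2) closedin_subset by blast
  \<comment> \<open>Every open set missing \<open>A\<close> belongs to this family, so it covers \<open>X\<close> and not only \<open>A\<close>.\<close>
  define \<U> where "\<U> = {U. openin X U \<and> (\<exists>s\<in>S. f ` (A \<inter> U) \<subseteq> Ys s)}"
  have "\<Union>\<U> = topspace X"
  proof
    show "\<Union>\<U> \<subseteq> topspace X" by (auto simp: \<U>_def dest: openin_subset)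
    show "topspace X \<subseteq> \<Union>\<U>"
    proof
      fix x assume x: "x \<in> topspace X"
      show "x \<in> \<Union>\<U>"
      proof (cases "x \<in> A")
        case True
        then obtain s where s: "s \<in> S" "x \<in> subtopology X A interior_of {x \<in> A. f x \<in> Ys s}"
          using assms(8) by blast
        then obtain W where W: "openin (subtopology X A) W" "x \<in> W" "W \<subseteq> {x \<in> A. f x \<in> Ys s}"
          unfolding interior_of_def by blast
        then obtain U where "openin X U" "W = U \<inter> A" by (auto simp: openin_subtopology)
        then have "U \<in> \<U>" "x \<in> U" using W s(1) by (auto simp: \<U>_def)
        then show ?thesis by blast
      next
        case False
        have "topspace X - A \<in> \<U>" using assms(2,4) by (auto simp: \<U>_def)
        then show ?thesis using x False by blast
      qed
    qed
  qed
  moreover have "\<forall>U\<in>\<U>. openin X U" by (simp add: \<U>_def)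
  ultimately obtain \<V> where "(\<forall>V\<in>\<V>. openin X V) \<and> \<Union>\<V> = topspace X \<and>
      (\<forall>V\<in>\<V>. \<exists>U\<in>\<U>. V \<subseteq> U) \<and> locally_finite_in X \<V>"
    using assms(1) unfolding paracompact_space_def by (elim conjE allE[of _ \<U>]) auto
  then have \<V>: "\<And>V. V \<in> \<V> \<Longrightarrow> openin X V" "\<Union>\<V> = topspace X"
      "\<And>V. V \<in> \<V> \<Longrightarrow> \<exists>U\<in>\<U>. V \<subseteq> U" "locally_finite_in X \<V>"
    by simp_all
  have "\<exists>s\<in>S. f ` (A \<inter> V) \<subseteq> Ys s" if "V \<in> \<V>" for V
    using \<V>(3)[OF that] unfolding \<U>_def by blast
  then obtain \<tau> where \<tau>: "\<And>V. V \<in> \<V> \<Longrightarrow> \<tau> V \<in> S" "\<And>V. V \<in> \<V> \<Longrightarrow> f ` (A \<inter> V) \<subseteq> Ys (\<tau> V)"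
    by metis
  have "\<exists>\<sigma>. \<forall>T. finite T \<and> T \<subseteq> \<V> \<longrightarrow> \<sigma> T \<in> S \<and>
      (\<forall>V\<in>T. Ys (\<tau> V) \<subseteq> Ys (\<sigma> T)) \<and> (\<forall>U. U \<subseteq> T \<longrightarrow> Ys (\<sigma> U) \<subseteq> Ys (\<sigma> T))"
    by (rule directed_choice_on_finite_sets[OF assms(4)]; rule assms(7) \<tau>(1); assumption)
  then obtain \<sigma> where "\<forall>T. finite T \<and> T \<subseteq> \<V> \<longrightarrow> \<sigma> T \<in> S \<and>
      (\<forall>V\<in>T. Ys (\<tau> V) \<subseteq> Ys (\<sigma> T)) \<and> (\<forall>U. U \<subseteq> T \<longrightarrow> Ys (\<sigma> U) \<subseteq> Ys (\<sigma> T))"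
    by (elim exE)
  then have \<sigma>: "\<sigma> T \<in> S" "\<And>V. V \<in> T \<Longrightarrow> Ys (\<tau> V) \<subseteq> Ys (\<sigma> T)"
      "\<And>U. U \<subseteq> T \<Longrightarrow> Ys (\<sigma> U) \<subseteq> Ys (\<sigma> T)" if "finite T" "T \<subseteq> \<V>" for T
    using that by simp_all
  have f_near: "f x \<in> Ys (\<sigma> {V \<in> \<V>. x \<in> V})" if "x \<in> A" for x
  proof -
    have x: "x \<in> topspace X" using that A_top by (rule subsetD[rotated])
    then obtain V where V: "V \<in> \<V>" "x \<in> V" unfolding \<V>(2)[symmetric] by (rule UnionE)
    obtain N where N: "x \<in> N" "finite {V \<in> \<V>. V \<inter> N \<noteq> {}}"
      using \<V>(4) x unfolding locally_finite_in_def by meson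
    have "{V \<in> \<V>. x \<in> V} \<subseteq> {V \<in> \<V>. V \<inter> N \<noteq> {}}" using N(1) by auto
    then have "finite {V \<in> \<V>. x \<in> V}" using N(2) finite_subset by blast
    then have "Ys (\<tau> V) \<subseteq> Ys (\<sigma> {V \<in> \<V>. x \<in> V})" using \<sigma>(2) V by auto
    then show ?thesis using \<tau>(2)[OF V(1)] V(2) that by auto
  qed
  show ?thesis
  proof (rule extend_over_locally_finite_cover[OF assms(2,3)])
    fix T assume "finite T" "T \<subseteq> \<V>"
    then show "absolute_extensor_of (subtopology Y (Ys (\<sigma> T))) X"
      using assms(6) \<sigma>(1) by simp
  next
    fix T U assume "finite T" "T \<subseteq> \<V>" "U \<subseteq> T"
    then show "Ys (\<sigma> U) \<subseteq> Ys (\<sigma> T)" by (rule \<sigma>(3))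
  next
    fix g assume "continuous_map X Y g" "\<And>x. x \<in> A \<Longrightarrow> g x = f x"
    then show ?thesis by blast
  qed (fact \<V>(1,4) f_near)+
qed

end
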